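(* For any integers $p\ge4$ and $q\ge3$, $\mathrm{def}_c(H_{p,q})=\mathrm{def}(H_{p,q})=pq-p-2q-2$.
   Context: All graphs are finite, simple and undirected. The Hertz graph $H_{p,q}$ ($p,q\ge2$) has vertex set $\{a,b_1,\dots,b_p,d\}\cup\{c^{(i)}_j:1\le i\le p,\ 1\le j\le q\}$ and edge set $\{ab_i:1\le i\le p\}\cup\{b_ic^{(i)}_j:1\le i\le p,1\le j\le q\}\cup\{c^{(i)}_jd:1\le i\le p,1\le j\le q\}$. An interval coloring is a proper edge coloring with positive integers such that the colors at every vertex form an interval of integers. A set $A\subseteq\{1,\dots,t\}$ is a cyclic interval modulo $t$ if $A$ or $\{1,\dots,t\}\setminus A$ is an interval of integers; a cyclic interval $t$-coloring is a proper edge coloring with colors $1,\dots,t$ in which the set of colors at every vertex is a cyclic interval modulo $t$. The deficiency $\mathrm{def}(G)$ (resp. cyclic deficiency $\mathrm{def}_c(G)$) is the minimum number of pendant edges whose attachment to $G$ yields a graph admitting an interval coloring (resp. a cyclic interval coloring). *)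

theory Defs
  imports Main
begin

record 'a graph =
  verts :: "'a set"
  edges :: "'a set set"

definition finite_simple_graph :: "'a graph \<Rightarrow> bool" where
  "finite_simple_graph G \<longleftrightarrow>
     finite (verts G) \<and> (\<forall>e\<in>edges G. e \<subseteq> verts G \<and> card e = 2)"

definition proper_edge_coloring :: "'a graph \<Rightarrow> ('a set \<Rightarrow> nat) \<Rightarrow> bool" where
  "proper_edge_coloring G f \<longleftrightarrow>
     (\<forall>e\<in>edges G. \<forall>e'\<in>edges G. e \<noteq> e' \<and> e \<inter> e' \<noteq> {} \<longrightarrow> f e \<noteq> f e')"

definition colors_at :: "'a graph \<Rightarrow> ('a set \<Rightarrow> nat) \<Rightarrow> 'a \<Rightarrow> nat set" where
  "colors_at G f v = f ` {e \<in> edges G. v \<in> e}"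

text \<open>The empty set counts as an interval (take \<open>a > b\<close>); it arises at isolated vertices
  and as the complement of \<open>{1..t}\<close>.\<close>

definition is_interval_of_ints :: "nat set \<Rightarrow> bool" where
  "is_interval_of_ints A \<longleftrightarrow> (\<exists>a b. A = {a..b})"

definition is_cyclic_interval :: "nat \<Rightarrow> nat set \<Rightarrow> bool" where
  "is_cyclic_interval t A \<longleftrightarrow>
     A \<subseteq> {1..t} \<and> (is_interval_of_ints A \<or> is_interval_of_ints ({1..t} - A))"

definition interval_coloring :: "'a graph \<Rightarrow> ('a set \<Rightarrow> nat) \<Rightarrow> bool" where
  "interval_coloring G f \<longleftrightarrow>
     proper_edge_coloring G f \<and> (\<forall>e\<in>edges G. f e \<ge> 1) \<and>
     (\<forall>v\<in>verts G. is_interval_of_ints (colors_at G f v))"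

text \<open>Not every color in \<open>{1..t}\<close> has to be used.\<close>

definition cyclic_interval_coloring :: "'a graph \<Rightarrow> nat \<Rightarrow> ('a set \<Rightarrow> nat) \<Rightarrow> bool" where
  "cyclic_interval_coloring G t f \<longleftrightarrow>
     proper_edge_coloring G f \<and> (\<forall>e\<in>edges G. f e \<in> {1..t}) \<and>
     (\<forall>v\<in>verts G. is_cyclic_interval t (colors_at G f v))"

definition interval_colorable :: "'a graph \<Rightarrow> bool" where
  "interval_colorable G \<longleftrightarrow> (\<exists>f. interval_coloring G f)"

definition cyclically_interval_colorable :: "'a graph \<Rightarrow> bool" where
  "cyclically_interval_colorable G \<longleftrightarrow> (\<exists>t f. cyclic_interval_coloring G t f)"

text \<open>Attach \<open>k v\<close> pendant edges at every vertex \<open>v\<close> of \<open>G\<close>; the new endpoints are the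
  vertices \<open>Inr (v, i)\<close> with \<open>i < k v\<close>.\<close>

definition attach_pendants :: "'a graph \<Rightarrow> ('a \<Rightarrow> nat) \<Rightarrow> ('a + 'a \<times> nat) graph" where
  "attach_pendants G k =
     \<lparr> verts = Inl ` verts G \<union> {Inr (v, i) | v i. v \<in> verts G \<and> i < k v},
       edges = (\<lambda>e. Inl ` e) ` edges G \<union> {{Inl v, Inr (v, i)} | v i. v \<in> verts G \<and> i < k v} \<rparr>"

definition deficiency :: "'a graph \<Rightarrow> nat" where
  "deficiency G =
     (LEAST n. \<exists>k. (\<Sum>v\<in>verts G. k v) = n \<and> interval_colorable (attach_pendants G k))"

definition cyclic_deficiency :: "'a graph \<Rightarrow> nat" where
  "cyclic_deficiency G =
     (LEAST n. \<exists>k. (\<Sum>v\<in>verts G. k v) = n \<and>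
        cyclically_interval_colorable (attach_pendants G k))"

datatype hertz_vertex = VA | VB nat | VC nat nat | VD

definition hertz_graph :: "nat \<Rightarrow> nat \<Rightarrow> hertz_vertex graph" where
  "hertz_graph p q =
     \<lparr> verts = {VA, VD} \<union> {VB i | i. i \<in> {1..p}}
                \<union> {VC i j | i j. i \<in> {1..p} \<and> j \<in> {1..q}},
       edges = {{VA, VB i} | i. i \<in> {1..p}}
                \<union> {{VB i, VC i j} | i j. i \<in> {1..p} \<and> j \<in> {1..q}}
                \<union> {{VC i j, VD} | i j. i \<in> {1..p} \<and> j \<in> {1..q}} \<rparr>"

lemma finite_simple_graph_hertz: "finite_simple_graph (hertz_graph p q)"
proof -
  have "{VC i j | i j. i \<in> {1..p} \<and> j \<in> {1..q}} = (\<lambda>(i, j). VC i j) ` ({1..p} \<times> {1..q})"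
    by auto
  then have "finite {VC i j | i j. i \<in> {1..p} \<and> j \<in> {1..q}}"
    by (metis finite_SigmaI finite_atLeastAtMost finite_imageI)
  then show ?thesis
    by (auto simp: finite_simple_graph_def hertz_graph_def)
qed

lemma finite_simple_graph_attach_pendants:
  assumes "finite_simple_graph G"
  shows "finite_simple_graph (attach_pendants G k)"
proof -
  have "{Inr (v, i) | v i. v \<in> verts G \<and> i < k v}
          = (Inr ` (SIGMA v:verts G. {..<k v}) :: ('a + 'a \<times> nat) set)"
    by auto
  moreover have "finite (SIGMA v:verts G. {..<k v})"
    using assms by (auto simp: finite_simple_graph_def)
  ultimately have "finite {Inr (v, i) :: 'a + 'a \<times> nat | v i. v \<in> verts G \<and> i < k v}"
    by simp
  then show ?thesis
    using assms
    by (auto simp: finite_simple_graph_def attach_pendants_def card_image subset_iff)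
qed

end

theory Submission
  imports Defs
begin

text \<open>Lower bound: deleting \<open>d\<close> from \<open>H\<^bsub>p,q\<^esub>\<close> leaves a tree, so a cyclic coloring can be lifted to
  integers, starting at \<open>a\<close>, so that the lifted colors of two edges meeting at a vertex \<open>v \<noteq> d\<close> differ
  by less than the degree of \<open>v\<close>. The \<open>p q\<close> edges at \<open>d\<close> get distinct lifts, hence two of them differ
  by at least \<open>p q - 1\<close>; the path joining these through \<open>a\<close> gives at most \<open>p + 2 q + 1\<close> plus the number
  of pendant edges.

  Upper bound: color \<open>c\<^sup>(\<^sup>i\<^sup>)\<^sub>j d\<close> with \<open>(i - 1) q + j\<close>, shift each block up or down by one to get the
  colors at \<open>b\<^sub>i\<close>, choose the colors of the edges \<open>a b\<^sub>i\<close> pairwise distinct in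
  \<open>{q + 2..p q - q - 1}\<close>, and fill up this interval with pendant edges at \<open>a\<close>.\<close>

section \<open>Lifting cyclic intervals\<close>

text \<open>If \<open>A\<close> wraps around, adding \<open>t\<close> to the colors below the gap
  makes it a run of consecutive integers. A translation by a multiple of \<open>t\<close> then gives
  \<open>x\<close> the prescribed lift \<open>X\<close>, so that lifts can be continued from vertex
  to vertex along a path.\<close>

lemma cyclic_interval_lift:
  assumes A: "is_cyclic_interval t A" and x: "x \<in> A" and X: "X mod int t = int x mod int t"
  obtains \<phi> where "\<phi> x = X" "\<And>y. y \<in> A \<Longrightarrow> \<phi> y mod int t = int y mod int t"
    "\<And>y z. y \<in> A \<Longrightarrow> z \<in> A \<Longrightarrow> \<bar>\<phi> y - \<phi> z\<bar> < int (card A)"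
proof -
  note lift = that
  have shifted: thesis if \<psi>: "\<And>y. \<psi> y mod int t = int y mod int t"
    and d: "\<And>y z. y \<in> A \<Longrightarrow> z \<in> A \<Longrightarrow> \<bar>\<psi> y - \<psi> z\<bar> < int (card A)" for \<psi>
  proof (rule lift[of "\<lambda>y. X - \<psi> x + \<psi> y"])
    fix y
    have "(X - \<psi> x) mod int t = 0"
      using X \<psi>[of x] by (metis mod_diff_cong diff_self mod_0)
    then show "(X - \<psi> x + \<psi> y) mod int t = int y mod int t"
      using \<psi>[of y] by (metis mod_add_left_eq add_0)
  qed (use d in \<open>auto simp: algebra_simps\<close>)
  have sub: "A \<subseteq> {1..t}" using A by (simp add: is_cyclic_interval_def)
  have interval: thesis if "A = {a..b}" for a b
    by (rule shifted[of int]) (use that in \<open>auto\<close>)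
  consider a b where "A = {a..b}" | a b where "{1..t} - A = {a..b}"
    using A by (auto simp: is_cyclic_interval_def is_interval_of_ints_def)
  then show thesis
  proof cases
    case 1
    then show thesis using interval by blast
  next
    case (2 a b)
    show thesis
    proof (cases "a \<le> b")
      case False
      then have "A = {1..t}" using 2 sub by auto
      then show thesis using interval by blast
    next
      case True
      have ab: "1 \<le> a" "b \<le> t"
        using 2 True by (metis DiffE atLeastAtMost_iff order_refl)+
      have A_eq: "A = {1..t} - {a..b}" using 2 sub by blast
      \<comment> \<open>The lifted colors lie in \<open>{b+1..t+a-1}\<close>, which has exactly this
        many elements; hence the strict bound on differences.\<close>
      have card: "int (card A) = int t - int b + int a - 1"
        unfolding A_eq using ab True by (subst card_Diff_subset) auto
      show thesis
      proof (rule shifted[of "\<lambda>y. int y + (if y < a then int t else 0)"])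
        fix y z assume "y \<in> A" "z \<in> A"
        then have "y \<le> t" "z \<le> t" "y < a \<or> b < y" "z < a \<or> b < z" "1 \<le> y" "1 \<le> z"
          by (auto simp: A_eq)
        then show "\<bar>int y + (if y < a then int t else 0) - (int z + (if z < a then int t else 0))\<bar>
            < int (card A)"
          unfolding card using ab True by auto
      qed auto
    qed
  qed
qed

section \<open>Attaching pendant edges\<close>

lemma edges_at_attach_pendants:
  assumes "v \<in> verts G"
  shows "{e \<in> edges (attach_pendants G k). Inl v \<in> e}
    = (\<lambda>e. Inl ` e) ` {e \<in> edges G. v \<in> e} \<union> (\<lambda>i. {Inl v, Inr (v, i)}) ` {..<k v}"
  using assms by (auto simp: attach_pendants_def)

lemma card_colors_at_attach_pendants_le:
  assumes "v \<in> verts G" and "finite {e \<in> edges G. v \<in> e}"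
  shows "card (colors_at (attach_pendants G k) f (Inl v)) \<le> card {e \<in> edges G. v \<in> e} + k v"
proof -
  have "card (colors_at (attach_pendants G k) f (Inl v))
      \<le> card ((\<lambda>e. Inl ` e :: ('a + 'a \<times> nat) set) ` {e \<in> edges G. v \<in> e}
          \<union> (\<lambda>i. {Inl v, Inr (v, i)}) ` {..<k v})"
    unfolding colors_at_def edges_at_attach_pendants[OF assms(1)]
    using assms(2) by (intro card_image_le) auto
  also have "\<dots> \<le> card {e \<in> edges G. v \<in> e} + card {..<k v}"
    by (rule order_trans[OF card_Un_le add_mono[OF card_image_le card_image_le]])
      (use assms(2) in auto)
  finally show ?thesis by simp
qed

text \<open>With \<open>t\<close> at least every color used, each interval of colors lies in
  \<open>{1..t}\<close> and is a cyclic interval. Thus one construction bounds both deficiencies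
  from above, and one cyclic lower bound serves both.\<close>

lemma interval_colorable_imp_cyclically:
  assumes "finite (edges G)" and "interval_colorable G"
  shows "cyclically_interval_colorable G"
proof -
  obtain f where f: "interval_coloring G f"
    using assms(2) by (auto simp: interval_colorable_def)
  define t where "t = Max (insert 0 (f ` edges G))"
  have "f e \<le> t" if "e \<in> edges G" for e
    unfolding t_def using that assms(1) by (intro Max_ge) auto
  then have "cyclic_interval_coloring G t f"
    using f by (auto simp: cyclic_interval_coloring_def interval_coloring_def
        is_cyclic_interval_def colors_at_def)
  then show ?thesis by (auto simp: cyclically_interval_colorable_def)
qed

lemma finite_edges_attach_pendants:
  assumes "finite_simple_graph G"
  shows "finite (edges (attach_pendants G k))"
proof -
  have "edges (attach_pendants G k) \<subseteq> Pow (verts (attach_pendants G k))"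
    and "finite (verts (attach_pendants G k))"
    using finite_simple_graph_attach_pendants[OF assms] by (auto simp: finite_simple_graph_def)
  then show ?thesis by (meson finite_Pow_iff finite_subset)
qed

section \<open>The lower bound\<close>

lemma hertz_edges_at:
  "{e \<in> edges (hertz_graph p q). VA \<in> e} = (\<lambda>i. {VA, VB i}) ` {1..p}"
  "i \<in> {1..p} \<Longrightarrow> {e \<in> edges (hertz_graph p q). VB i \<in> e}
     = insert {VA, VB i} ((\<lambda>j. {VB i, VC i j}) ` {1..q})"
  "i \<in> {1..p} \<Longrightarrow> j \<in> {1..q} \<Longrightarrow> {e \<in> edges (hertz_graph p q). VC i j \<in> e}
     = {{VB i, VC i j}, {VC i j, VD}}"
  by (auto simp: hertz_graph_def) blast

text \<open>Two lifts at \<open>d\<close> differ by at most \<open>p - 1\<close> across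
  \<open>a\<close>, \<open>q\<close> across each of two vertices \<open>b\<close>, and
  \<open>1\<close> across each of two vertices \<open>c\<close>, plus the pendant edges at these
  five vertices. A spread of at least \<open>p * q - 1\<close> is forced, which gives the
  inequality.\<close>

lemma hertz_cyclic_lower_bound:
  assumes pq: "1 \<le> p" "1 \<le> q"
    and col: "cyclic_interval_coloring (attach_pendants (hertz_graph p q) k) t f"
  shows "p * q \<le> p + 2 * q + 2 + (\<Sum>v\<in>verts (hertz_graph p q). k v)"
proof -
  define G where "G = attach_pendants (hertz_graph p q) k"
  define V where "V = verts (hertz_graph p q)"
  define ea where "ea i = f {Inl VA, Inl (VB i)}" for i
  define eb where "eb i j = f {Inl (VB i), Inl (VC i j)}" for i j
  define ec where "ec i j = f {Inl (VC i j), Inl VD}" for i j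
  define C where "C v = colors_at G f (Inl v)" for v
  define I where "I = {1..p} \<times> {1..q}"
  have V: "VA \<in> V" "VD \<in> V" "\<And>i. i \<in> {1..p} \<Longrightarrow> VB i \<in> V"
    "\<And>i j. i \<in> {1..p} \<Longrightarrow> j \<in> {1..q} \<Longrightarrow> VC i j \<in> V"
    by (auto simp: V_def hertz_graph_def)
  have E: "{Inl u, Inl v} \<in> edges G" if "{u, v} \<in> edges (hertz_graph p q)" for u v
    using that unfolding G_def attach_pendants_def by (auto intro!: image_eqI[of _ _ "{u, v}"])
  have Ea: "{Inl VA, Inl (VB i)} \<in> edges G" if "i \<in> {1..p}" for i
    using that by (intro E) (auto simp: hertz_graph_def)
  have Eb: "{Inl (VB i), Inl (VC i j)} \<in> edges G" if "i \<in> {1..p}" "j \<in> {1..q}" for i j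
    using that by (intro E) (auto simp: hertz_graph_def)
  have Ec: "{Inl (VC i j), Inl VD} \<in> edges G" if "i \<in> {1..p}" "j \<in> {1..q}" for i j
    using that by (intro E) (auto simp: hertz_graph_def)
  have cyc: "is_cyclic_interval t (C v)" if "v \<in> V" for v
    using col that unfolding cyclic_interval_coloring_def C_def G_def V_def
    by (auto simp: attach_pendants_def)
  have mem: "ea i \<in> C VA" "ea i \<in> C (VB i)" if "i \<in> {1..p}" for i
    using Ea[OF that] by (auto simp: C_def colors_at_def ea_def)
  have mem': "eb i j \<in> C (VB i)" "eb i j \<in> C (VC i j)" "ec i j \<in> C (VC i j)"
    if "i \<in> {1..p}" "j \<in> {1..q}" for i j
    using Eb[OF that] Ec[OF that] by (auto simp: C_def colors_at_def eb_def ec_def)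
  have card_C: "card (C v) \<le> n + k v"
    if "v \<in> V" "finite {e \<in> edges (hertz_graph p q). v \<in> e}"
      "card {e \<in> edges (hertz_graph p q). v \<in> e} \<le> n" for v n
    using card_colors_at_attach_pendants_le[of v "hertz_graph p q" k f] that
    unfolding C_def G_def V_def by linarith
  have card_A: "card (C VA) \<le> p + k VA"
    by (rule card_C) (use V card_image_le[of "{1..p}" "\<lambda>i. {VA, VB i}"]
        in \<open>auto simp: hertz_edges_at\<close>)
  have card_B: "card (C (VB i)) \<le> q + 1 + k (VB i)" if "i \<in> {1..p}" for i
    by (rule card_C) (use that V card_image_le[of "{1..q}" "\<lambda>j. {VB i, VC i j}"]
        in \<open>auto simp: hertz_edges_at card_insert_if\<close>)
  have card_Cc: "card (C (VC i j)) \<le> 2 + k (VC i j)" if "i \<in> {1..p}" "j \<in> {1..q}" for i j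
    by (rule card_C) (use that V in \<open>auto simp: hertz_edges_at card_insert_if\<close>)

  have one: "1 \<in> {1..p}" using pq by simp
  \<comment> \<open>The color of the edge from \<open>a\<close> to \<open>b\<close> with index 1 is
    its own lift; this fixes the base point of all lifts.\<close>
  obtain A where A: "\<And>y. y \<in> C VA \<Longrightarrow> A y mod int t = int y mod int t"
    "\<And>y z. y \<in> C VA \<Longrightarrow> z \<in> C VA \<Longrightarrow> \<bar>A y - A z\<bar> < int (card (C VA))"
    using cyclic_interval_lift[OF cyc[OF V(1)] mem(1)[OF one] refl] by metis
  define \<alpha> where "\<alpha> i = A (ea i)" for i
  \<comment> \<open>The lift at each \<open>VB i\<close> is anchored at the shared spoke, so it
    agrees there with the lift at \<open>VA\<close>.\<close>
  have "\<forall>i\<in>{1..p}. \<exists>B. B (ea i) = \<alpha> i \<and> (\<forall>y\<in>C (VB i). B y mod int t = int y mod int t)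
      \<and> (\<forall>y\<in>C (VB i). \<forall>z\<in>C (VB i). \<bar>B y - B z\<bar> < int (card (C (VB i))))"
  proof
    fix i assume i: "i \<in> {1..p}"
    show "\<exists>B. B (ea i) = \<alpha> i \<and> (\<forall>y\<in>C (VB i). B y mod int t = int y mod int t)
      \<and> (\<forall>y\<in>C (VB i). \<forall>z\<in>C (VB i). \<bar>B y - B z\<bar> < int (card (C (VB i))))"
      using cyclic_interval_lift[OF cyc[OF V(3)[OF i]] mem(2)[OF i] A(1)[OF mem(1)[OF i]]]
      unfolding \<alpha>_def by metis
  qed
  then obtain B where B: "\<And>i. i \<in> {1..p} \<Longrightarrow> B i (ea i) = \<alpha> i"
    "\<And>i y. i \<in> {1..p} \<Longrightarrow> y \<in> C (VB i) \<Longrightarrow> B i y mod int t = int y mod int t"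
    "\<And>i y z. i \<in> {1..p} \<Longrightarrow> y \<in> C (VB i) \<Longrightarrow> z \<in> C (VB i) \<Longrightarrow>
        \<bar>B i y - B i z\<bar> < int (card (C (VB i)))"
    by (subst (asm) bchoice_iff) blast
  define \<beta> where "\<beta> i j = B i (eb i j)" for i j
  \<comment> \<open>The lift at \<open>VC i j\<close> is anchored at \<open>\<beta> i j\<close>;
    only its value on the edge to \<open>VD\<close> is kept.\<close>
  have "\<exists>g. g mod int t = int (ec i j) mod int t \<and> \<bar>g - \<beta> i j\<bar> \<le> 1 + int (k (VC i j))"
    if ij: "i \<in> {1..p}" "j \<in> {1..q}" for i j
  proof -
    obtain D where D: "D (eb i j) = \<beta> i j"
      "\<And>y. y \<in> C (VC i j) \<Longrightarrow> D y mod int t = int y mod int t"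
      "\<And>y z. y \<in> C (VC i j) \<Longrightarrow> z \<in> C (VC i j) \<Longrightarrow> \<bar>D y - D z\<bar> < int (card (C (VC i j)))"
      using cyclic_interval_lift[OF cyc[OF V(4)[OF ij]] mem'(2)[OF ij]
          B(2)[OF ij(1) mem'(1)[OF ij]]]
      unfolding \<beta>_def by metis
    show ?thesis
      using D(1) D(2)[OF mem'(3)[OF ij]] D(3)[OF mem'(3)[OF ij] mem'(2)[OF ij]] card_Cc[OF ij]
      by (intro exI[of _ "D (ec i j)"]) auto
  qed
  then have "\<forall>x\<in>I. \<exists>g. g mod int t = int (ec (fst x) (snd x)) mod int t
      \<and> \<bar>g - \<beta> (fst x) (snd x)\<bar> \<le> 1 + int (k (VC (fst x) (snd x)))"
    by (auto simp: I_def)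
  then obtain \<gamma> where \<gamma>: "\<And>x. x \<in> I \<Longrightarrow> \<gamma> x mod int t = int (ec (fst x) (snd x)) mod int t"
    "\<And>x. x \<in> I \<Longrightarrow> \<bar>\<gamma> x - \<beta> (fst x) (snd x)\<bar> \<le> 1 + int (k (VC (fst x) (snd x)))"
    by (subst (asm) bchoice_iff) blast

  have \<alpha>: "\<bar>\<alpha> i - \<alpha> i'\<bar> < int p + int (k VA)" if "i \<in> {1..p}" "i' \<in> {1..p}" for i i'
    using A(2)[OF mem(1)[OF that(1)] mem(1)[OF that(2)]] card_A by (simp add: \<alpha>_def)
  have \<beta>\<alpha>: "\<bar>\<beta> i j - \<alpha> i\<bar> \<le> int q + int (k (VB i))" if "i \<in> {1..p}" "j \<in> {1..q}" for i j
    using B(1)[OF that(1)] B(3)[OF that(1) mem'(1)[OF that] mem(2)[OF that(1)]] card_B[OF that(1)]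
    by (simp add: \<beta>_def)
  have \<beta>\<beta>: "\<bar>\<beta> i j - \<beta> i j'\<bar> \<le> int q + int (k (VB i))"
    if "i \<in> {1..p}" "j \<in> {1..q}" "j' \<in> {1..q}" for i j j'
    using B(3)[OF that(1) mem'(1)[OF that(1,2)] mem'(1)[OF that(1,3)]] card_B[OF that(1)]
    by (simp add: \<beta>_def)

  have proper: "e = e'" if "e \<in> edges G" "e' \<in> edges G" "f e = f e'" "e \<inter> e' \<noteq> {}" for e e'
    using col that unfolding cyclic_interval_coloring_def proper_edge_coloring_def G_def
    by metis
  \<comment> \<open>Equal lifts give congruent colors; both lie in \<open>{1..t}\<close>, so they
    coincide, and properness at \<open>VD\<close> makes the edges equal.\<close>
  have inj: "inj_on \<gamma> I"
  proof (rule inj_onI)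
    fix x y assume x: "x \<in> I" and y: "y \<in> I" and eq: "\<gamma> x = \<gamma> y"
    obtain i j i' j' where xy: "x = (i, j)" "y = (i', j')" by (metis surj_pair)
    have ij: "i \<in> {1..p}" "j \<in> {1..q}" "i' \<in> {1..p}" "j' \<in> {1..q}"
      using x y by (auto simp: xy I_def)
    have rng: "ec i j \<in> {1..t}" "ec i' j' \<in> {1..t}"
      using col Ec[OF ij(1,2)] Ec[OF ij(3,4)]
      unfolding cyclic_interval_coloring_def G_def ec_def by blast+
    have "int (ec i j) mod int t = int (ec i' j') mod int t"
      using \<gamma>(1)[OF x] \<gamma>(1)[OF y] eq by (simp add: xy)
    then have "int t dvd int (ec i j) - int (ec i' j')" by (simp add: mod_eq_dvd_iff)
    moreover have "\<bar>int (ec i j) - int (ec i' j')\<bar> < int t" using rng by auto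
    ultimately have "ec i j = ec i' j'"
      using dvd_imp_le_int[of "int (ec i j) - int (ec i' j')" "int t"] by fastforce
    moreover have "{Inl (VC i j), Inl VD} \<inter> {Inl (VC i' j'), Inl VD :: hertz_vertex + _} \<noteq> {}"
      by auto
    ultimately have "{Inl (VC i j), Inl VD :: hertz_vertex + hertz_vertex \<times> nat}
        = {Inl (VC i' j'), Inl VD}"
      using proper[OF Ec[OF ij(1,2)] Ec[OF ij(3,4)]] by (simp add: ec_def)
    then show "x = y" by (auto simp: xy doubleton_eq_iff)
  qed
  have finI: "finite (\<gamma> ` I)" "\<gamma> ` I \<noteq> {}" using pq by (auto simp: I_def)
  obtain x where x: "x \<in> I" "Max (\<gamma> ` I) = \<gamma> x" using Max_in[OF finI] by blast
  obtain y where y: "y \<in> I" "Min (\<gamma> ` I) = \<gamma> y" using Min_in[OF finI] by blast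
  have "\<gamma> ` I \<subseteq> {\<gamma> y..\<gamma> x}"
    using finI x(2) y(2) by (auto simp flip: x(2) y(2))
  then have "card (\<gamma> ` I) \<le> card {\<gamma> y..\<gamma> x}" by (intro card_mono) auto
  then have "p * q \<le> nat (\<gamma> x - \<gamma> y + 1)" using inj by (simp add: card_image I_def)
  then have "int (p * q) \<le> int (nat (\<gamma> x - \<gamma> y + 1))" by (simp only: of_nat_le_iff)
  \<comment> \<open>The \<open>max 0\<close> accounts for the truncation in
    \<open>nat\<close>.\<close>
  then have spread: "int p * int q \<le> max 0 (\<gamma> x - \<gamma> y + 1)"
    by (auto simp: max_def split: if_splits)
  obtain i j i' j' where xy: "x = (i, j)" "y = (i', j')" by (metis surj_pair)
  have ij: "i \<in> {1..p}" "j \<in> {1..q}" "i' \<in> {1..p}" "j' \<in> {1..q}"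
    using x y by (auto simp: xy I_def)
  define K where "K = sum k V"
  have sum_le: "sum k S \<le> K" if "S \<subseteq> V" for S
    unfolding K_def using that finite_simple_graph_hertz[of p q]
    by (intro sum_mono2) (auto simp: V_def finite_simple_graph_def)
  have xb: "\<bar>\<gamma> x - \<beta> i j\<bar> \<le> 1 + int (k (VC i j))"
    and yb: "\<bar>\<gamma> y - \<beta> i' j'\<bar> \<le> 1 + int (k (VC i' j'))"
    using \<gamma>(2)[OF x(1)] \<gamma>(2)[OF y(1)] by (auto simp: xy)
  have "\<gamma> x - \<gamma> y \<le> int p + 2 * int q + 1 + int K"
  proof -
    \<comment> \<open>Edges from the same branch are joined directly through \<open>VB i\<close>: a
      detour through \<open>VA\<close> would count the pendant edges at \<open>VB i\<close>
      twice.\<close>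
    consider "i = i'" "j = j'" | "i = i'" "j \<noteq> j'" | "i \<noteq> i'" by blast
    then show ?thesis
    proof cases
      case 1
      then have "\<gamma> x = \<gamma> y" by (simp add: xy)
      then show ?thesis by simp
    next
      case 2
      have "k (VB i) + k (VC i j) + k (VC i' j') \<le> K"
        using sum_le[of "{VB i, VC i j, VC i' j'}"] ij V 2 by simp
      then show ?thesis
        using \<beta>\<beta>[OF ij(1,2,4)] xb yb 2 pq by (simp add: 2)
    next
      case 3
      have "k VA + k (VB i) + k (VB i') + k (VC i j) + k (VC i' j') \<le> K"
        using sum_le[of "{VA, VB i, VB i', VC i j, VC i' j'}"] ij V 3 by simp
      then show ?thesis
        using \<alpha>[OF ij(1,3)] \<beta>\<alpha>[OF ij(1,2)] \<beta>\<alpha>[OF ij(3,4)] xb yb by linarith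
    qed
  qed
  then have "int (p * q) \<le> int (p + 2 * q + 2 + K)"
    using spread by simp
  then show ?thesis unfolding K_def V_def by linarith
qed

section \<open>The coloring\<close>

text \<open>Names for the edges, so that colors can be given by pattern matching and transferred to
  sets of vertices through the injection \<open>edge_of\<close>. \<open>EP\<close> names the pendant
  edges, all at \<open>VA\<close>.\<close>

datatype edge_index = EA nat | EB nat nat | EC nat nat | EP nat

fun edge_of :: "edge_index \<Rightarrow> (hertz_vertex + hertz_vertex \<times> nat) set" where
  "edge_of (EA i) = {Inl VA, Inl (VB i)}"
| "edge_of (EB i j) = {Inl (VB i), Inl (VC i j)}"
| "edge_of (EC i j) = {Inl (VC i j), Inl VD}"
| "edge_of (EP r) = {Inl VA, Inr (VA, r)}"

lemma inj_edge_of: "inj edge_of"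
proof (rule injI)
  fix x y show "edge_of x = edge_of y \<Longrightarrow> x = y"
    by (cases x; cases y) (auto simp: doubleton_eq_iff)
qed

definition edge_indices :: "nat \<Rightarrow> nat \<Rightarrow> nat \<Rightarrow> edge_index set" where
  "edge_indices p q n = EA ` {1..p} \<union> (\<lambda>(i, j). EB i j) ` ({1..p} \<times> {1..q})
     \<union> (\<lambda>(i, j). EC i j) ` ({1..p} \<times> {1..q}) \<union> EP ` {..<n}"

lemma edges_attach_hertz:
  "edges (attach_pendants (hertz_graph p q) (\<lambda>v. if v = VA then n else 0))
     = edge_of ` edge_indices p q n"
proof -
  have "edges (hertz_graph p q) = (\<lambda>i. {VA, VB i}) ` {1..p}
      \<union> (\<lambda>(i, j). {VB i, VC i j}) ` ({1..p} \<times> {1..q})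
      \<union> (\<lambda>(i, j). {VC i j, VD}) ` ({1..p} \<times> {1..q})"
    unfolding hertz_graph_def by auto
  moreover have "{{Inl v, Inr (v, i)} | v i. v \<in> verts (hertz_graph p q)
      \<and> i < (if v = VA then n else 0)} = (\<lambda>i. {Inl VA, Inr (VA, i)}) ` {..<n}"
    unfolding hertz_graph_def by (auto split: if_splits)
  ultimately show ?thesis
    unfolding attach_pendants_def edge_indices_def
    by (simp add: image_Un image_image case_prod_unfold)
qed

text \<open>The generic rule, shifting up and adding the color below, would give spoke
  \<open>q + 1\<close> at index 2 and \<open>(p - 1) * q + 1\<close> at index \<open>p\<close>, both
  outside \<open>{q + 2..p * q - q - 1}\<close>. Shifting these two blocks down brings the spokes
  inside.\<close>

definition shift_down :: "nat \<Rightarrow> nat \<Rightarrow> bool" where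
  "shift_down p i \<longleftrightarrow> i = 2 \<or> i = p"

text \<open>The shifted block at \<open>b\<^sub>i\<close> becomes an interval of length \<open>q + 1\<close> in two ways, by adding the color
  just below or just above it; the choice here makes the added color strictly increasing in \<open>i\<close>.\<close>

definition spoke_color :: "nat \<Rightarrow> nat \<Rightarrow> nat \<Rightarrow> nat" where
  "spoke_color p q i =
     (if i = 1 then q + 2 else if i = 2 then 2 * q else if i = p then (p - 1) * q - 1
      else (i - 1) * q + 1)"

fun index_color :: "nat \<Rightarrow> nat \<Rightarrow> (nat \<Rightarrow> nat) \<Rightarrow> edge_index \<Rightarrow> nat" where
  "index_color p q g (EA i) = spoke_color p q i"
| "index_color p q g (EB i j) =
     (if shift_down p i then (i - 1) * q + j - 1 else (i - 1) * q + j + 1)"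
| "index_color p q g (EC i j) = (i - 1) * q + j"
| "index_color p q g (EP r) = g r"

section \<open>Arithmetic of the color blocks\<close>

lemma mult_pred_add_le:
  fixes i i' q :: nat
  assumes "1 \<le> i" "i < i'"
  shows "(i - 1) * q + q \<le> (i' - 1) * q"
proof -
  have "Suc (i - 1) * q \<le> (i' - 1) * q" using assms by (intro mult_le_mono1) auto
  then show ?thesis by simp
qed

text \<open>The critical comparisons are \<open>q + 2 < 2 * q\<close> at the start and
  \<open>(p - 2) * q + 1 < (p - 1) * q - 1\<close> at the end, both from \<open>q \<ge> 3\<close>.
  For \<open>p = 3\<close> the last spoke would be \<open>2 * q - 1\<close>, below the second
  one.\<close>

lemma spoke_color_less:
  assumes "4 \<le> p" "3 \<le> q" "1 \<le> i" "i < i'" "i' \<le> p"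
  shows "spoke_color p q i < spoke_color p q i'"
proof -
  \<comment> \<open>Naming the products leaves only linear comparisons once the block inequalities
    are supplied.\<close>
  define u where "u = (i - 1) * q"
  define w where "w = (i' - 1) * q"
  define r where "r = (p - 1) * q"
  have "u + q \<le> w" using assms mult_pred_add_le by (simp add: u_def w_def)
  moreover have "3 * q \<le> r"
    unfolding r_def using assms by (intro mult_le_mono1) auto
  moreover have "2 * q \<le> w" if "i' \<noteq> 2"
    unfolding w_def using that assms by (intro mult_le_mono1) auto
  moreover have "2 * q \<le> u" if "i \<noteq> 2" "i \<noteq> 1"
    unfolding u_def using that assms by (intro mult_le_mono1) auto
  moreover have "w = r" if "i' = p" using that by (simp add: w_def r_def)
  ultimately show ?thesis
    using assms unfolding spoke_color_def u_def[symmetric] w_def[symmetric] r_def[symmetric]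
    by auto
qed

lemma spoke_color_bounds:
  assumes "4 \<le> p" "3 \<le> q" "i \<in> {1..p}"
  shows "spoke_color p q i \<in> {q + 2..p * q - q - 1}"
proof -
  have "spoke_color p q 1 \<le> spoke_color p q i"
    using spoke_color_less[of p q 1 i] assms by (cases "i = 1") auto
  moreover have "spoke_color p q i \<le> spoke_color p q p"
    using spoke_color_less[of p q i p] assms by (cases "i = p") auto
  moreover have "spoke_color p q 1 = q + 2" "spoke_color p q p = p * q - q - 1"
    using assms by (auto simp: spoke_color_def algebra_simps)
  ultimately show ?thesis by simp
qed

lemma inj_on_spoke_color:
  assumes "4 \<le> p" "3 \<le> q"
  shows "inj_on (spoke_color p q) {1..p}"
proof (rule inj_onI)
  fix i i' assume "i \<in> {1..p}" "i' \<in> {1..p}" "spoke_color p q i = spoke_color p q i'"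
  then show "i = i'"
    using spoke_color_less[of p q i i'] spoke_color_less[of p q i' i] assms
    by (cases i i' rule: linorder_cases) auto
qed

text \<open>Blocks with different \<open>i\<close> are disjoint, and within a block \<open>j\<close>
  is the offset.\<close>

lemma inj_on_hub_color:
  "inj_on (\<lambda>(i, j). (i - 1) * q + j) ({1..p} \<times> {1..q :: nat})"
proof (rule inj_onI, clarify)
  fix i j i' j' :: nat
  assume "i \<in> {1..p}" "j \<in> {1..q}" "i' \<in> {1..p}" "j' \<in> {1..q}"
    and "(i - 1) * q + j = (i' - 1) * q + j'"
  then show "i = i' \<and> j = j'"
    using mult_pred_add_le[of i i' q] mult_pred_add_le[of i' i q]
    by (cases i i' rule: linorder_cases) auto
qed

lemma hub_color_image:
  "(\<lambda>(i, j). (i - 1) * q + j) ` ({1..p} \<times> {1..q :: nat}) = {1..p * q}"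
proof (rule card_subset_eq)
  have "(i - 1) * q + j \<le> p * q" if "i \<in> {1..p}" "j \<in> {1..q}" for i j
    using that mult_pred_add_le[of i "p + 1" q] by auto
  then show "(\<lambda>(i, j). (i - 1) * q + j) ` ({1..p} \<times> {1..q}) \<subseteq> {1..p * q}"
    by auto
  show "card ((\<lambda>(i, j). (i - 1) * q + j) ` ({1..p} \<times> {1..q})) = card {1..p * q}"
    by (subst card_image[OF inj_on_hub_color]) simp
qed simp

text \<open>The \<open>q + 1\<close> edges at \<open>VB i\<close> receive exactly the colors
  \<open>{lo..lo + q}\<close>; injectivity then follows by counting.\<close>

lemma branch_colors:
  assumes "4 \<le> p" "3 \<le> q" "i \<in> {1..p}"
  defines "X \<equiv> insert (EA i) (EB i ` {1..q})"
  shows "inj_on (index_color p q g) X" "is_interval_of_ints (index_color p q g ` X)"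
proof -
  define m where "m = (i - 1) * q"
  \<comment> \<open>The spoke has the top color of the interval for \<open>i = 1\<close> and
    \<open>i = 2\<close>, and the bottom color otherwise.\<close>
  define lo where "lo = (if i = 1 then 2 else if i = 2 then q else if i = p then m - 1 else m + 1)"
  define b where "b = (if shift_down p i then m - 1 else m + 1)"
  \<comment> \<open>Keeps \<open>m - 1\<close> from truncating in the blocks that are shifted
    down.\<close>
  have m: "q \<le> m" if "i \<noteq> 1"
    using that assms(3) mult_pred_add_le[of 1 i q] by (simp add: m_def)
  have colors: "index_color p q g (EB i j) = b + j" if "1 \<le> j" for j
    using that m assms by (auto simp: b_def m_def shift_down_def)
  have "index_color p q g ` EB i ` {1..q} = (\<lambda>j. b + j) ` {1..q}"
    unfolding image_image using colors by (intro image_cong) auto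
  also have "\<dots> = {b + 1..b + q}"
    by (simp only: image_add_atLeastAtMost) (simp only: add.commute)
  finally have image: "index_color p q g ` X = insert (spoke_color p q i) {b + 1..b + q}"
    by (simp add: X_def)
  have "insert (spoke_color p q i) {b + 1..b + q} = {lo..lo + q}"
    using m assms(1-3) by (auto simp: spoke_color_def b_def lo_def shift_down_def m_def)
  with image have image': "index_color p q g ` X = {lo..lo + q}" by simp
  then show "is_interval_of_ints (index_color p q g ` X)"
    by (auto simp: is_interval_of_ints_def)
  show "inj_on (index_color p q g) X"
  proof (rule eq_card_imp_inj_on)
    have "card X = Suc q"
      unfolding X_def by (subst card_insert_disjoint) (auto simp: card_image inj_on_def)
    then show "card (index_color p q g ` X) = card X" by (simp add: image')
  qed (simp add: X_def)
qed

section \<open>Assembling the interval coloring\<close>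

lemma interval_coloringI:
  assumes "finite_simple_graph G" and "\<And>e. e \<in> edges G \<Longrightarrow> 1 \<le> f e"
    and "\<And>v. v \<in> verts G \<Longrightarrow>
      inj_on f {e \<in> edges G. v \<in> e} \<and> is_interval_of_ints (colors_at G f v)"
  shows "interval_coloring G f"
  unfolding interval_coloring_def proper_edge_coloring_def
proof (intro conjI ballI impI)
  fix e e' assume e: "e \<in> edges G" "e' \<in> edges G" "e \<noteq> e' \<and> e \<inter> e' \<noteq> {}"
  then obtain v where v: "v \<in> e" "v \<in> e'" by blast
  then have "v \<in> verts G" using assms(1) e(1) by (auto simp: finite_simple_graph_def)
  then have "inj_on f {e \<in> edges G. v \<in> e}" using assms(3) by blast
  then show "f e \<noteq> f e'" using e v by (auto dest: inj_onD)
qed (use assms in auto)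

lemma hertz_interval_colorable:
  assumes p: "4 \<le> p" and q: "3 \<le> q" and n: "n + p + 2 * q + 2 = p * q"
  shows "interval_colorable (attach_pendants (hertz_graph p q) (\<lambda>v. if v = VA then n else 0))"
proof -
  define G where "G = attach_pendants (hertz_graph p q) (\<lambda>v. if v = VA then n else 0)"
  define S where "S = {q + 2..p * q - q - 1} - spoke_color p q ` {1..p}"
  have spokes: "spoke_color p q ` {1..p} \<subseteq> {q + 2..p * q - q - 1}"
    using spoke_color_bounds[OF p q] by blast
  \<comment> \<open>The interval has \<open>p * q - 2 * q - 2 = n + p\<close> elements, of which the
    spokes occupy \<open>p\<close>; the rest are the colors for the pendant edges.\<close>
  have "card S = n"
    unfolding S_def using n spokes inj_on_spoke_color[OF p q]
    by (subst card_Diff_subset) (auto simp: card_image)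
  then obtain g where g: "bij_betw g {..<n} S"
    using ex_bij_betw_nat_finite[of S] by (auto simp: S_def atLeast0LessThan)
  define h where "h = index_color p q g"
  define f where "f e = h (inv edge_of e)" for e
  have f_edge: "f (edge_of x) = h x" for x
    by (simp add: f_def inv_f_f[OF inj_edge_of])
  have edges_G: "edges G = edge_of ` edge_indices p q n"
    unfolding G_def by (rule edges_attach_hertz)
  have positive: "1 \<le> h x" if "x \<in> edge_indices p q n" for x
  proof -
    have "q + 2 \<le> h (EA i)" if "i \<in> {1..p}" for i
      using spoke_color_bounds[OF p q that] by (simp add: h_def)
    moreover have "1 \<le> h (EB i j)" if "i \<in> {1..p}" "1 \<le> j" for i j
    proof (cases "shift_down p i")
      case True
      then have "q \<le> (i - 1) * q"
        using p mult_pred_add_le[of 1 i q] by (auto simp: shift_down_def)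
      then have "1 \<le> (i - 1) * q + j - 1" using q that by linarith
      then show ?thesis using True by (simp add: h_def)
    qed (simp add: h_def)
    moreover have "q + 2 \<le> h (EP r)" if "r < n" for r
      using bij_betwE[OF g] that by (auto simp: h_def S_def)
    ultimately show ?thesis
      using that by (fastforce simp: edge_indices_def h_def)
  qed
  \<comment> \<open>Moves both conditions at a vertex from edges to edge names, where the cases
    below are checked.\<close>
  have at: "inj_on f {e \<in> edges G. v \<in> e} \<and> is_interval_of_ints (colors_at G f v)"
    if "X = {x \<in> edge_indices p q n. v \<in> edge_of x}" "inj_on h X" "is_interval_of_ints (h ` X)"
    for v X
  proof -
    have X: "{e \<in> edges G. v \<in> e} = edge_of ` X"
      unfolding edges_G that(1) by blast
    show ?thesis
      unfolding colors_at_def X using that(2,3)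
      by (auto simp: inj_on_def f_edge image_image)
  qed
  have "interval_coloring G f"
  proof (rule interval_coloringI)
    show "finite_simple_graph G"
      unfolding G_def by (intro finite_simple_graph_attach_pendants finite_simple_graph_hertz)
    show "1 \<le> f e" if "e \<in> edges G" for e
      using that positive by (auto simp: edges_G f_edge)
    fix v assume "v \<in> verts G"
    then consider "v = Inl VA" | "v = Inl VD" | i where "v = Inl (VB i)" "i \<in> {1..p}"
      | i j where "v = Inl (VC i j)" "i \<in> {1..p}" "j \<in> {1..q}"
      | r where "v = Inr (VA, r)" "r < n"
      by (auto simp: G_def attach_pendants_def hertz_graph_def split: if_splits)
    then show "inj_on f {e \<in> edges G. v \<in> e} \<and> is_interval_of_ints (colors_at G f v)"
    proof cases
      case 1
      show ?thesis
      proof (rule at)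
        show "EA ` {1..p} \<union> EP ` {..<n} = {x \<in> edge_indices p q n. v \<in> edge_of x}"
          by (auto simp: 1 edge_indices_def)
        have "h ` (EA ` {1..p} \<union> EP ` {..<n}) = spoke_color p q ` {1..p} \<union> g ` {..<n}"
          by (simp add: image_Un image_image h_def)
        also have "\<dots> = {q + 2..p * q - q - 1}"
          using spokes g by (auto simp: bij_betw_def S_def)
        finally have image: "h ` (EA ` {1..p} \<union> EP ` {..<n}) = {q + 2..p * q - q - 1}" .
        then show "is_interval_of_ints (h ` (EA ` {1..p} \<union> EP ` {..<n}))"
          by (auto simp: is_interval_of_ints_def)
        \<comment> \<open>As many edges as colors, so the coloring is injective at
          \<open>VA\<close>.\<close>
        have "card (EA ` {1..p} \<union> EP ` {..<n}) = p + n"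
          by (subst card_Un_disjoint) (auto simp: card_image inj_on_def)
        moreover have "card (h ` (EA ` {1..p} \<union> EP ` {..<n})) = p + n"
          unfolding image using n by simp
        ultimately show "inj_on h (EA ` {1..p} \<union> EP ` {..<n})"
          by (intro eq_card_imp_inj_on) auto
      qed
    next
      case 2
      let ?X = "(\<lambda>(i, j). EC i j) ` ({1..p} \<times> {1..q})"
      show ?thesis
      proof (rule at)
        show "?X = {x \<in> edge_indices p q n. v \<in> edge_of x}"
          by (auto simp: 2 edge_indices_def)
        have comp: "h \<circ> (\<lambda>(i, j). EC i j) = (\<lambda>(i, j). (i - 1) * q + j)"
          by (simp add: fun_eq_iff h_def)
        show "inj_on h ?X"
          by (intro inj_on_imageI) (simp only: comp inj_on_hub_color)
        have "h ` ?X = {1..p * q}"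
          by (simp only: image_comp comp hub_color_image)
        then show "is_interval_of_ints (h ` ?X)"
          by (auto simp: is_interval_of_ints_def)
      qed
    next
      case (3 i)
      show ?thesis
      proof (rule at)
        show "insert (EA i) (EB i ` {1..q}) = {x \<in> edge_indices p q n. v \<in> edge_of x}"
          using 3 by (auto simp: edge_indices_def)
      qed (use branch_colors[OF p q 3(2)] in \<open>simp_all only: h_def\<close>)
    next
      case (4 i j)
      \<comment> \<open>This is why blocks are shifted by exactly one: the two colors at
        \<open>VC i j\<close> become neighbors.\<close>
      have consecutive: "h (EB i j) = Suc (h (EC i j)) \<or> Suc (h (EB i j)) = h (EC i j)"
        using 4 by (auto simp: h_def)
      show ?thesis
      proof (rule at)
        show "{EB i j, EC i j} = {x \<in> edge_indices p q n. v \<in> edge_of x}"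
          using 4 by (auto simp: edge_indices_def)
        show "inj_on h {EB i j, EC i j}" using consecutive by auto
        have "h ` {EB i j, EC i j} = {min (h (EB i j)) (h (EC i j))..max (h (EB i j)) (h (EC i j))}"
          using consecutive by auto
        then show "is_interval_of_ints (h ` {EB i j, EC i j})"
          by (auto simp: is_interval_of_ints_def)
      qed
    next
      case (5 r)
      show ?thesis
      proof (rule at)
        show "{EP r} = {x \<in> edge_indices p q n. v \<in> edge_of x}"
          using 5 by (auto simp: edge_indices_def)
        show "is_interval_of_ints (h ` {EP r})"
          unfolding is_interval_of_ints_def
          by (intro exI[of _ "h (EP r)"]) simp
      qed simp
    qed
  qed
  then show ?thesis by (auto simp: G_def interval_colorable_def)
qed

theorem theorem12:
  fixes p q :: nat
  assumes "p \<ge> 4" and "q \<ge> 3"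
  shows "cyclic_deficiency (hertz_graph p q) = deficiency (hertz_graph p q) \<and>
         int (deficiency (hertz_graph p q)) = int p * int q - int p - 2 * int q - 2"
proof -
  let ?H = "hertz_graph p q"
  \<comment> \<open>After this substitution the difference of the two sides is
    \<open>p' * q' + 2 * p' + 2 * q'\<close>, so \<open>n\<close> exists as a natural number; it is
    0 for \<open>p = 4\<close>, \<open>q = 3\<close>.\<close>
  obtain p' q' where "p = 4 + p'" "q = 3 + q'" using assms by (metis le_Suc_ex)
  then have "p + 2 * q + 2 \<le> p * q" by (simp add: algebra_simps)
  then obtain n where n: "n + p + 2 * q + 2 = p * q" by (metis add.commute add.assoc le_Suc_ex)
  define k where "k v = (if v = VA then n else 0)" for v
  have fin: "finite (verts ?H)"
    using finite_simple_graph_hertz[of p q] by (simp add: finite_simple_graph_def)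
  have sum_k: "sum k (verts ?H) = n"
    unfolding k_def using fin by (subst sum.delta) (auto simp: hertz_graph_def)
  have colorable: "interval_colorable (attach_pendants ?H k)"
    unfolding k_def using hertz_interval_colorable[OF assms n] .
  have cyclic: "cyclically_interval_colorable (attach_pendants ?H k')"
    if "interval_colorable (attach_pendants ?H k')" for k'
    using interval_colorable_imp_cyclically[OF
        finite_edges_attach_pendants[OF finite_simple_graph_hertz] that] .
  \<comment> \<open>Proved for cyclic colorings; through \<open>cyclic\<close> it also bounds
    \<open>deficiency\<close>, while \<open>colorable\<close> supplies the witness for both
    minima.\<close>
  have lower: "n \<le> sum k' (verts ?H)"
    if "cyclically_interval_colorable (attach_pendants ?H k')" for k'
    using that hertz_cyclic_lower_bound[of p q k'] assms n
    by (fastforce simp: cyclically_interval_colorable_def)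
  have "deficiency ?H = n"
    unfolding deficiency_def
    by (rule Least_equality) (use sum_k colorable lower cyclic in blast)+
  moreover have "cyclic_deficiency ?H = n"
    unfolding cyclic_deficiency_def
    by (rule Least_equality) (use sum_k colorable lower cyclic in blast)+
  moreover have "int n = int p * int q - int p - 2 * int q - 2"
    using arg_cong[OF n, of int] by simp
  ultimately show ?thesis by simp
qed

end
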